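(* Let $(\gamma^{(k)})_{k\ge 0}$ be a sequence in $\mathbb{R}^n_{++}$ such that $x^{(k)}:=\mu(\gamma^{(k)})$ satisfies $x^{(k)}_i\neq 0$ for all $1\le i\le n$ and all $k\ge 0$. Then the iteration scheme $$\gamma^{(k+1)}=\mathop{\arg\min}_{\gamma\in\mathbb{R}^n_{++}} F(x^{(k)},\gamma)+\tilde g_{\mathrm{EM}}(\gamma,\gamma^{(k)}),\qquad k\ge 0,$$ is equivalent to the EM algorithm $$\gamma^{(k+1)}_i=[\mu(\gamma^{(k)})]_i^2+[\Sigma(\gamma^{(k)})]_{ii},\qquad 1\le i\le n,\ k\ge 0;$$ that is, $(\gamma^{(k)})$ satisfies the first recursion for every $k$ (meaning $\gamma^{(k+1)}$ is the unique minimizer) if and only if it satisfies the second recursion for every $k$, so that from the same initial estimate $\gamma^{(0)}$ both generate the same sequence.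
   Context: Setting: $\mathsf F\in\mathbb{R}^{m\times n}$ is a given matrix, $y\in\mathbb{R}^m$, $\beta>0$. $\mathbb{R}^n_{++}=\{u\in\mathbb{R}^n:u_i>0\ \forall i\}$. For $\gamma\in\mathbb{R}^n_{++}$ let $\Gamma=\operatorname{diag}(\gamma)$, $S(\gamma)=\beta^{-1}I+\mathsf F\Gamma\mathsf F^{T}$, $\mu(\gamma)=\Gamma\mathsf F^{T}S(\gamma)^{-1}y\in\mathbb{R}^n$, and $\Sigma(\gamma)=\Gamma-\Gamma\mathsf F^{T}S(\gamma)^{-1}\mathsf F\Gamma$. For $x\in\mathbb{R}^n$, $\gamma\in\mathbb{R}^n_{++}$, $$F(x,\gamma)=\beta\|\mathsf Fx-y\|^2+\sum_{i=1}^n\frac{x_i^2}{\gamma_i}.$$ The EM surrogate function is, for $\gamma,\gamma^{(k)}\in\mathbb{R}^n_{++}$, $$\tilde g_{\mathrm{EM}}(\gamma,\gamma^{(k)})=\phi(s^{(k)})+\sum_{i=1}^n[\Sigma(\gamma^{(k)})]_{ii}\Big(\frac1{\gamma_i}-\frac1{\gamma_i^{(k)}}\Big)+\sum_{i=1}^n\log\gamma_i-m\log\beta,$$ where $s^{(k)}_i=1/\gamma^{(k)}_i$ and $\phi(s)=\log\det(\operatorname{diag}(s)+\beta\mathsf F^{T}\mathsf F)$. *)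

theory Defs
  imports "HOL-Analysis.Analysis"
begin

definition pos_orthant :: "(real ^ 'n) set" where
  "pos_orthant = {u. \<forall>i. u $ i > 0}"

definition diag_mat :: "real ^ 'n \<Rightarrow> real ^ 'n ^ 'n" where
  "diag_mat v = (\<chi> i j. if i = j then v $ i else 0)"

definition S_mat :: "real ^ 'n ^ 'm \<Rightarrow> real \<Rightarrow> real ^ 'n \<Rightarrow> real ^ 'm ^ 'm" where
  "S_mat F \<beta> \<gamma> = (1 / \<beta>) *\<^sub>R mat 1 + F ** diag_mat \<gamma> ** transpose F"

(* For \<beta> > 0 and \<gamma> in the positive orthant, S_mat is positive definite, so matrix_inv below is
   the genuine two-sided inverse. *)
definition mu :: "real ^ 'n ^ 'm \<Rightarrow> real ^ 'm \<Rightarrow> real \<Rightarrow> real ^ 'n \<Rightarrow> real ^ 'n" where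
  "mu F y \<beta> \<gamma> = (diag_mat \<gamma> ** transpose F ** matrix_inv (S_mat F \<beta> \<gamma>)) *v y"

definition Sigma_mat :: "real ^ 'n ^ 'm \<Rightarrow> real \<Rightarrow> real ^ 'n \<Rightarrow> real ^ 'n ^ 'n" where
  "Sigma_mat F \<beta> \<gamma> =
     diag_mat \<gamma>
     - diag_mat \<gamma> ** transpose F ** matrix_inv (S_mat F \<beta> \<gamma>) ** F ** diag_mat \<gamma>"

definition F_obj ::
  "real ^ 'n ^ 'm \<Rightarrow> real ^ 'm \<Rightarrow> real \<Rightarrow> real ^ 'n \<Rightarrow> real ^ 'n \<Rightarrow> real" where
  "F_obj F y \<beta> x \<gamma> = \<beta> * (norm (F *v x - y))\<^sup>2 + (\<Sum>i\<in>UNIV. (x $ i)\<^sup>2 / \<gamma> $ i)"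

definition phi :: "real ^ 'n ^ 'm \<Rightarrow> real \<Rightarrow> real ^ 'n \<Rightarrow> real" where
  "phi F \<beta> s = ln (det (diag_mat s + \<beta> *\<^sub>R (transpose F ** F)))"

definition g_EM ::
  "real ^ 'n ^ 'm \<Rightarrow> real \<Rightarrow> real ^ 'n \<Rightarrow> real ^ 'n \<Rightarrow> real" where
  "g_EM F \<beta> \<gamma> \<gamma>k =
     phi F \<beta> (\<chi> i. 1 / \<gamma>k $ i)
     + (\<Sum>i\<in>UNIV. Sigma_mat F \<beta> \<gamma>k $ i $ i * (1 / \<gamma> $ i - 1 / \<gamma>k $ i))
     + (\<Sum>i\<in>UNIV. ln (\<gamma> $ i))
     - real CARD('m) * ln \<beta>"

definition is_unique_minimizer :: "('a \<Rightarrow> real) \<Rightarrow> 'a set \<Rightarrow> 'a \<Rightarrow> bool" where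
  "is_unique_minimizer f A a \<longleftrightarrow>
     is_arg_min f (\<lambda>u. u \<in> A) a \<and> (\<forall>b. is_arg_min f (\<lambda>u. u \<in> A) b \<longrightarrow> b = a)"

(* The x-iterate is x^(k) = mu (\<gamma> k); argmin is read as the unique minimizer. *)
definition surrogate_recursion ::
  "real ^ 'n ^ 'm \<Rightarrow> real ^ 'm \<Rightarrow> real \<Rightarrow> (nat \<Rightarrow> real ^ 'n) \<Rightarrow> bool" where
  "surrogate_recursion F y \<beta> \<gamma> \<longleftrightarrow>
     (\<forall>k. is_unique_minimizer
            (\<lambda>g. F_obj F y \<beta> (mu F y \<beta> (\<gamma> k)) g + g_EM F \<beta> g (\<gamma> k))
            pos_orthant (\<gamma> (Suc k)))"

definition EM_recursion ::
  "real ^ 'n ^ 'm \<Rightarrow> real ^ 'm \<Rightarrow> real \<Rightarrow> (nat \<Rightarrow> real ^ 'n) \<Rightarrow> bool" where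
  "EM_recursion F y \<beta> \<gamma> \<longleftrightarrow>
     (\<forall>k i. \<gamma> (Suc k) $ i =
        (mu F y \<beta> (\<gamma> k) $ i)\<^sup>2 + Sigma_mat F \<beta> (\<gamma> k) $ i $ i)"

end

theory Submission
  imports Defs
begin

text \<open>
  As a function of \<open>\<gamma>\<close> the surrogate objective is, up to a constant,
  \<open>\<Sum>\<^sub>i (c\<^sub>i / \<gamma>\<^sub>i + ln \<gamma>\<^sub>i)\<close> with
  \<open>c\<^sub>i = x\<^sub>i\<^sup>2 + \<Sigma>\<^sub>i\<^sub>i\<close>. The diagonal of \<open>\<Sigma>\<close> is nonnegative and
  \<open>x\<^sub>i \<noteq> 0\<close>, so \<open>c\<^sub>i > 0\<close>, and each summand is minimized exactly at
  \<open>\<gamma>\<^sub>i = c\<^sub>i\<close> because \<open>ln t \<le> t - 1\<close> with equality only at \<open>t = 1\<close>.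
\<close>

text \<open>The product \<open>F ** diag_mat \<gamma> ** transpose F\<close> is a sum of rank-one
  matrices, one per column of \<open>F\<close>, weighted by the entries of \<gamma>, so its
  quadratic form splits by columns. This gives both invertibility and the bound on the diagonal of
  \<open>Sigma_mat\<close>.\<close>

lemma inner_S_mat:
  fixes F :: "real ^ 'n ^ 'm"
  shows "w \<bullet> (S_mat F \<beta> \<gamma> *v w) = (norm w)\<^sup>2 / \<beta> + (\<Sum>j\<in>UNIV. \<gamma> $ j * (column j F \<bullet> w)\<^sup>2)"
proof -
  define v where "v = transpose F *v w"
  have v: "v $ j = column j F \<bullet> w" for j
    by (simp add: v_def matrix_vector_mult_def transpose_def column_def inner_vec_def)
  have D: "(diag_mat \<gamma> *v v) $ j = \<gamma> $ j * v $ j" for j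
    by (simp add: diag_mat_def matrix_vector_mult_def if_distrib[of "\<lambda>x. x * _"] cong: if_cong)
  have "w \<bullet> ((F ** diag_mat \<gamma> ** transpose F) *v w) = w \<bullet> (F *v (diag_mat \<gamma> *v v))"
    unfolding v_def by (simp only: matrix_vector_mul_assoc matrix_mul_assoc)
  also have "\<dots> = v \<bullet> (diag_mat \<gamma> *v v)"
    by (simp add: v_def dot_lmul_matrix[symmetric])
  also have "\<dots> = (\<Sum>j\<in>UNIV. \<gamma> $ j * (column j F \<bullet> w)\<^sup>2)"
    unfolding inner_vec_def[of v] by (simp add: D v power2_eq_square mult_ac)
  finally show ?thesis
    by (simp add: S_mat_def matrix_vector_mult_add_rdistrib inner_add_right
        scaleR_matrix_vector_assoc[symmetric] power2_norm_eq_inner)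
qed

lemma invertible_S_mat:
  fixes F :: "real ^ 'n ^ 'm"
  assumes "\<beta> > 0" and "\<gamma> \<in> pos_orthant"
  shows "invertible (S_mat F \<beta> \<gamma>)"
proof -
  \<comment> \<open>For a square matrix a trivial kernel suffices; both parts of the quadratic form
    are nonnegative, so the norm term must vanish.\<close>
  have "w = 0" if "S_mat F \<beta> \<gamma> *v w = 0" for w
  proof -
    have "(\<Sum>j\<in>UNIV. \<gamma> $ j * (column j F \<bullet> w)\<^sup>2) \<ge> 0"
      using assms(2) by (intro sum_nonneg mult_nonneg_nonneg) (auto simp: pos_orthant_def less_imp_le)
    then have "(norm w)\<^sup>2 / \<beta> \<le> 0"
      using inner_S_mat[of w F \<beta> \<gamma>] that by simp
    with \<open>\<beta> > 0\<close> show ?thesis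
      by (simp add: divide_le_0_iff)
  qed
  then show ?thesis
    by (simp add: invertible_left_inverse matrix_left_invertible_ker)
qed

lemma matrix_mult_matrix_inv:
  assumes "invertible A"
  shows "A ** matrix_inv A = mat 1"
  using someI_ex[OF assms[unfolded invertible_def]] by (simp add: matrix_inv_def)

lemma Sigma_mat_diagonal:
  fixes F :: "real ^ 'n ^ 'm"
  shows "Sigma_mat F \<beta> \<gamma> $ i $ i =
    \<gamma> $ i - (\<gamma> $ i)\<^sup>2 * (column i F \<bullet> (matrix_inv (S_mat F \<beta> \<gamma>) *v column i F))"
proof -
  define M where "M = matrix_inv (S_mat F \<beta> \<gamma>)"
  have right: "(A ** diag_mat \<gamma>) $ a $ b = A $ a $ b * \<gamma> $ b" for A :: "real ^ 'n ^ 'k" and a b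
    by (simp add: matrix_matrix_mult_def diag_mat_def if_distrib[of "\<lambda>x. _ * x"] cong: if_cong)
  have left: "(diag_mat \<gamma> ** A) $ a $ b = \<gamma> $ a * A $ a $ b" for A :: "real ^ 'k ^ 'n" and a b
    by (simp add: matrix_matrix_mult_def diag_mat_def if_distrib[of "\<lambda>x. x * _"] cong: if_cong)
  have "(transpose F ** (M ** F)) $ i $ i = column i F \<bullet> (M *v column i F)"
    by (simp add: matrix_matrix_mult_def matrix_vector_mult_def transpose_def column_def inner_vec_def)
  then have "(diag_mat \<gamma> ** transpose F ** M ** F ** diag_mat \<gamma>) $ i $ i
      = (\<gamma> $ i)\<^sup>2 * (column i F \<bullet> (M *v column i F))"
    \<comment> \<open>Nesting to the right exposes the leading diagonal factor; the second pass
      nests to the left to expose the trailing one.\<close>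
    by (simp add: right left matrix_mul_assoc[symmetric] power2_eq_square)
       (simp add: right left matrix_mul_assoc power2_eq_square)
  then show ?thesis
    by (simp add: Sigma_mat_def M_def diag_mat_def)
qed

text \<open>Let f be column i of \<open>F\<close>, w the solution of S w = f, and t the inner
  product of f and w. Then t equals the quadratic form of S at w, which is at least \<gamma>_i t^2.
  Hence \<gamma>_i t \<le> 1, and the diagonal entry is \<gamma>_i (1 - \<gamma>_i t).\<close>

lemma Sigma_mat_diagonal_nonneg:
  fixes F :: "real ^ 'n ^ 'm"
  assumes "\<beta> > 0" and "\<gamma> \<in> pos_orthant"
  shows "Sigma_mat F \<beta> \<gamma> $ i $ i \<ge> 0"
proof -
  define w where "w = matrix_inv (S_mat F \<beta> \<gamma>) *v column i F"
  define t where "t = column i F \<bullet> w"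
  have pos: "\<gamma> $ j > 0" for j
    using assms(2) by (simp add: pos_orthant_def)
  have "S_mat F \<beta> \<gamma> *v w = column i F"
    using invertible_S_mat[OF assms, of F]
    by (simp add: w_def matrix_vector_mul_assoc matrix_mult_matrix_inv)
  then have "t = (norm w)\<^sup>2 / \<beta> + (\<Sum>j\<in>UNIV. \<gamma> $ j * (column j F \<bullet> w)\<^sup>2)"
    using inner_S_mat[of w F \<beta> \<gamma>] by (simp add: t_def inner_commute)
  \<comment> \<open>Only the summand j = i of the quadratic form is kept.\<close>
  moreover have "\<gamma> $ i * t\<^sup>2 \<le> (\<Sum>j\<in>UNIV. \<gamma> $ j * (column j F \<bullet> w)\<^sup>2)"
    unfolding t_def using pos
    by (intro member_le_sum[where f = "\<lambda>j. \<gamma> $ j * (column j F \<bullet> w)\<^sup>2"]) (auto simp: less_imp_le)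
  moreover have "(norm w)\<^sup>2 / \<beta> \<ge> 0"
    using assms(1) by simp
  ultimately have le: "\<gamma> $ i * t * t \<le> 1 * t"
    by (simp add: power2_eq_square mult.assoc)
  have "\<gamma> $ i * t \<le> 1"
  proof (cases "t > 0")
    case True
    with le show ?thesis
      by (simp only: mult_le_cancel_right_pos)
  next
    case False
    then have "\<gamma> $ i * t \<le> 0"
      using pos[of i] by (simp add: mult_nonneg_nonpos)
    then show ?thesis by simp
  qed
  then have "0 \<le> \<gamma> $ i * (1 - \<gamma> $ i * t)"
    using pos[of i] by simp
  then show ?thesis
    by (simp add: Sigma_mat_diagonal w_def t_def power2_eq_square algebra_simps)
qed

text \<open>The unsimplified \<open>c / c\<close> makes both sides values of one function, at
  \<open>c\<close> and at \<open>t\<close>.\<close>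

lemma divide_add_ln_less:
  fixes c t :: real
  assumes "c > 0" "t > 0" "t \<noteq> c"
  shows "c / c + ln c < c / t + ln t"
proof -
  have "ln (c / t) \<noteq> c / t - 1"
    using ln_eq_minus_one[of "c / t"] assms by auto
  moreover have "ln (c / t) \<le> c / t - 1"
    using assms by (intro ln_le_minus_one) simp
  ultimately show ?thesis
    using assms by (simp add: ln_div)
qed

text \<open>The terms separate by coordinate: each is weakly smaller at \<open>c\<close>, and a
  coordinate where \<open>g\<close> differs from \<open>c\<close> makes the sum strictly
  smaller.\<close>

lemma sum_divide_add_ln_less:
  fixes c g :: "real ^ 'n"
  assumes "c \<in> pos_orthant" "g \<in> pos_orthant" "g \<noteq> c"
  shows "(\<Sum>i\<in>UNIV. c $ i / c $ i + ln (c $ i)) < (\<Sum>i\<in>UNIV. c $ i / g $ i + ln (g $ i))"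
proof (rule sum_strict_mono_ex1)
  show "\<forall>i\<in>UNIV. c $ i / c $ i + ln (c $ i) \<le> c $ i / g $ i + ln (g $ i)"
    using assms divide_add_ln_less by (metis less_le mem_Collect_eq order_refl pos_orthant_def)
  show "\<exists>i\<in>UNIV. c $ i / c $ i + ln (c $ i) < c $ i / g $ i + ln (g $ i)"
    using assms divide_add_ln_less by (metis UNIV_I mem_Collect_eq pos_orthant_def vec_eq_iff)
qed simp

lemma is_unique_minimizer_iff:
  assumes "a \<in> A" and "\<And>b. b \<in> A \<Longrightarrow> b \<noteq> a \<Longrightarrow> f a < f b"
  shows "is_unique_minimizer f A b \<longleftrightarrow> b = a"
proof -
  have "is_arg_min f (\<lambda>u. u \<in> A) b \<longleftrightarrow> b = a" for b
    using assms unfolding is_arg_min_def by (metis less_asym)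
  then show ?thesis
    by (auto simp: is_unique_minimizer_def)
qed

lemma surrogate_step_iff_EM_step:
  fixes F :: "real ^ 'n ^ 'm"
  assumes "\<beta> > 0" and "\<gamma> \<in> pos_orthant" and "\<And>i. x $ i \<noteq> 0"
  shows "is_unique_minimizer (\<lambda>g. F_obj F y \<beta> x g + g_EM F \<beta> g \<gamma>) pos_orthant h \<longleftrightarrow>
    (\<forall>i. h $ i = (x $ i)\<^sup>2 + Sigma_mat F \<beta> \<gamma> $ i $ i)"
proof -
  define c where "c = (\<chi> i. (x $ i)\<^sup>2 + Sigma_mat F \<beta> \<gamma> $ i $ i)"
  \<comment> \<open>\<open>K\<close> collects all terms free of the variable \<open>g\<close>,
    including the part of the surrogate with 1/\<gamma>_i at the current iterate.\<close>
  define K where "K = \<beta> * (norm (F *v x - y))\<^sup>2 + phi F \<beta> (\<chi> i. 1 / \<gamma> $ i)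
    - (\<Sum>i\<in>UNIV. Sigma_mat F \<beta> \<gamma> $ i $ i / \<gamma> $ i) - real CARD('m) * ln \<beta>"
  have objective: "F_obj F y \<beta> x g + g_EM F \<beta> g \<gamma> = K + (\<Sum>i\<in>UNIV. c $ i / g $ i + ln (g $ i))" for g
    by (simp add: F_obj_def g_EM_def K_def c_def right_diff_distrib sum_subtractf sum.distrib
        add_divide_distrib)
  \<comment> \<open>The squares of the nonzero \<open>x $ i\<close> turn nonnegativity of the
    diagonal into strict positivity, so the minimizer lies in the open orthant.\<close>
  have c: "c \<in> pos_orthant"
    using Sigma_mat_diagonal_nonneg[OF assms(1,2), of F] assms(3)
    by (auto simp: c_def pos_orthant_def intro!: add_pos_nonneg)
  have "is_unique_minimizer (\<lambda>g. F_obj F y \<beta> x g + g_EM F \<beta> g \<gamma>) pos_orthant h \<longleftrightarrow> h = c"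
    using c sum_divide_add_ln_less[OF c] by (intro is_unique_minimizer_iff) (auto simp: objective)
  then show ?thesis
    by (simp add: c_def vec_eq_iff)
qed

theorem proposition3p2:
  fixes F :: "real ^ 'n ^ 'm" and y :: "real ^ 'm" and \<beta> :: real
    and \<gamma> :: "nat \<Rightarrow> real ^ 'n"
  assumes "\<beta> > 0"
    and "\<And>k. \<gamma> k \<in> pos_orthant"
    and "\<And>k i. mu F y \<beta> (\<gamma> k) $ i \<noteq> 0"
  shows "(surrogate_recursion F y \<beta> \<gamma> \<longleftrightarrow> EM_recursion F y \<beta> \<gamma>) \<and>
    (\<forall>\<gamma>'. \<gamma>' 0 = \<gamma> 0 \<longrightarrow>
       (surrogate_recursion F y \<beta> \<gamma> \<and> EM_recursion F y \<beta> \<gamma>' \<or>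
        EM_recursion F y \<beta> \<gamma> \<and> surrogate_recursion F y \<beta> \<gamma>') \<longrightarrow>
       \<gamma>' = \<gamma>)"
proof -
  have step: "is_unique_minimizer
      (\<lambda>g. F_obj F y \<beta> (mu F y \<beta> (\<gamma> k)) g + g_EM F \<beta> g (\<gamma> k)) pos_orthant h \<longleftrightarrow>
      (\<forall>i. h $ i = (mu F y \<beta> (\<gamma> k) $ i)\<^sup>2 + Sigma_mat F \<beta> (\<gamma> k) $ i $ i)" for k h
    using assms by (intro surrogate_step_iff_EM_step)
  have equiv: "surrogate_recursion F y \<beta> \<gamma> \<longleftrightarrow> EM_recursion F y \<beta> \<gamma>"
    by (simp add: surrogate_recursion_def EM_recursion_def step)
  \<comment> \<open>Positivity and nonvanishing means are assumed for \<gamma> only. The induction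
    therefore first replaces \<open>\<gamma>' k\<close> by \<open>\<gamma> k\<close>, after which
    \<open>step\<close> applies with its arbitrary \<open>h\<close> taken as
    \<open>\<gamma>' (Suc k)\<close>.\<close>
  have "\<gamma>' = \<gamma>"
    if init: "\<gamma>' 0 = \<gamma> 0" and EM: "EM_recursion F y \<beta> \<gamma>"
      and rec: "EM_recursion F y \<beta> \<gamma>' \<or> surrogate_recursion F y \<beta> \<gamma>'" for \<gamma>'
  proof
    fix k
    show "\<gamma>' k = \<gamma> k"
    proof (induction k)
      case 0
      show ?case by (fact init)
    next
      case (Suc k)
      have "\<forall>i. \<gamma>' (Suc k) $ i = (mu F y \<beta> (\<gamma> k) $ i)\<^sup>2 + Sigma_mat F \<beta> (\<gamma> k) $ i $ i"
        using rec
      proof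
        assume "EM_recursion F y \<beta> \<gamma>'"
        then have "\<forall>i. \<gamma>' (Suc k) $ i = (mu F y \<beta> (\<gamma>' k) $ i)\<^sup>2 + Sigma_mat F \<beta> (\<gamma>' k) $ i $ i"
          unfolding EM_recursion_def by blast
        then show ?thesis unfolding Suc .
      next
        assume "surrogate_recursion F y \<beta> \<gamma>'"
        then have "is_unique_minimizer
            (\<lambda>g. F_obj F y \<beta> (mu F y \<beta> (\<gamma>' k)) g + g_EM F \<beta> g (\<gamma>' k)) pos_orthant (\<gamma>' (Suc k))"
          unfolding surrogate_recursion_def by blast
        then show ?thesis unfolding Suc step .
      qed
      then show ?case
        using EM by (simp add: EM_recursion_def vec_eq_iff)
    qed
  qed
  with equiv show ?thesis by blast
qed

end
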